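(* Let $\mathscr{H}$ be a complex Hilbert space and let $A,B,X\in\mathbb{B}(\mathscr{H})$ be such that $A$ and $B$ are positive. Then $$w^{r}(A^\alpha X B^\alpha)\leq \|X\|^{r}\,\Big\|\frac{1}{p}A^{pr}+\frac{1}{q}B^{qr}\Big\|^{\alpha}$$ for all $0\leq\alpha\leq 1$, all $r\geq 0$ and all $p,q>1$ with $\frac{1}{p}+\frac{1}{q}=1$ and $pr\geq 2$, $qr\geq 2$.
   Context: $\mathbb{B}(\mathscr{H})$ denotes the $C^*$-algebra of all bounded linear operators on the complex Hilbert space $\mathscr{H}$, and $\|\cdot\|$ is the operator norm. An operator $A\in\mathbb{B}(\mathscr{H})$ is called positive if $\langle Ax,x\rangle\geq 0$ for all $x\in\mathscr{H}$ (so positive means positive semidefinite; invertibility is not required). The numerical radius of $A\in\mathbb{B}(\mathscr{H})$ is $w(A)=\sup\{|\langle Ax,x\rangle| : x\in\mathscr{H},\ \|x\|=1\}$, and $w^s(A)$ means $(w(A))^s$. Real powers of positive operators are defined by continuous functional calculus, with $A^0=I$ and, for scalars, $t^0=1$ for all $t\ge 0$. *)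

theory Defs
  imports "HOL-Analysis.Analysis" "HOL-Computational_Algebra.Polynomial"
begin

text \<open>
  Complex Hilbert spaces, as Banach spaces whose norm comes from a complex inner product.
  The inner product is linear in its first argument. Positive definiteness is not listed among
  the axioms because it follows from those on the norm (lemmas below).
\<close>

class complex_hilbert_space = banach +
  fixes scaleC :: "complex \<Rightarrow> 'a \<Rightarrow> 'a" (infixr "*\<^sub>C" 75)
    and cinner :: "'a \<Rightarrow> 'a \<Rightarrow> complex"
  assumes scaleC_add_right: "c *\<^sub>C (x + y) = c *\<^sub>C x + c *\<^sub>C y"
    and scaleC_add_left: "(c + d) *\<^sub>C x = c *\<^sub>C x + d *\<^sub>C x"
    and scaleC_scaleC: "c *\<^sub>C (d *\<^sub>C x) = (c * d) *\<^sub>C x"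
    and scaleC_of_real: "complex_of_real t *\<^sub>C x = t *\<^sub>R x"
    and cinner_commute: "cinner x y = cnj (cinner y x)"
    and cinner_add_left: "cinner (x + y) z = cinner x z + cinner y z"
    and cinner_scaleC_left: "cinner (c *\<^sub>C x) y = c * cinner x y"
    and norm_eq_sqrt_cinner: "norm x = sqrt (Re (cinner x x))"

lemma cinner_self_nonneg:
  fixes x :: "'a::complex_hilbert_space"
  shows "cinner x x \<in> \<real>\<^sub>\<ge>\<^sub>0"
proof -
  have "Im (cinner x x) = 0"
    using arg_cong[OF cinner_commute[of x x], of Im] by simp
  moreover have "0 \<le> Re (cinner x x)"
    using norm_ge_zero[of x] by (simp add: norm_eq_sqrt_cinner)
  ultimately show ?thesis by (simp add: complex_nonneg_Reals_iff)
qed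

lemma cinner_self_eq_0_iff:
  fixes x :: "'a::complex_hilbert_space"
  shows "cinner x x = 0 \<longleftrightarrow> x = 0"
proof -
  have "Im (cinner x x) = 0"
    using cinner_self_nonneg[of x] by (simp add: complex_nonneg_Reals_iff)
  then have "cinner x x = 0 \<longleftrightarrow> norm x = 0"
    by (simp add: norm_eq_sqrt_cinner complex_eq_iff)
  then show ?thesis by simp
qed

definition bounded_clinear :: "('a::complex_hilbert_space \<Rightarrow> 'a) \<Rightarrow> bool" where
  "bounded_clinear A \<longleftrightarrow> bounded_linear A \<and> (\<forall>c x. A (c *\<^sub>C x) = c *\<^sub>C A x)"

definition positive_op :: "('a::complex_hilbert_space \<Rightarrow> 'a) \<Rightarrow> bool" where
  "positive_op A \<longleftrightarrow> (\<forall>x. cinner (A x) x \<in> \<real>\<^sub>\<ge>\<^sub>0)"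

text \<open>
  The supremum is taken in the nonnegative reals: the inserted 0 only matters on the zero space,
  which has no unit vectors, and gives the numerical radius 0 there.
\<close>

definition numerical_radius :: "('a::complex_hilbert_space \<Rightarrow> 'a) \<Rightarrow> real" where
  "numerical_radius A = Sup (insert 0 {cmod (cinner (A x) x) |x. norm x = 1})"

definition spectrum :: "('a::complex_hilbert_space \<Rightarrow> 'a) \<Rightarrow> complex set" where
  "spectrum A = {l. \<not> (\<exists>T. bounded_clinear T \<and>
     (\<forall>x. T (A x - l *\<^sub>C x) = x) \<and> (\<forall>x. A (T x) - l *\<^sub>C T x = x))}"

definition poly_op :: "real poly \<Rightarrow> ('a::complex_hilbert_space \<Rightarrow> 'a) \<Rightarrow> 'a \<Rightarrow> 'a" where
  "poly_op p A = (\<lambda>x. \<Sum>i\<le>degree p. coeff p i *\<^sub>R (A ^^ i) x)"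

text \<open>
  Continuous functional calculus of a self-adjoint operator \<open>A\<close>, for a real function \<open>f\<close>
  continuous on the spectrum: the extension of the polynomial calculus by uniform limits on the
  spectrum, that is, \<open>f(A)\<close> is the operator norm limit of \<open>P n(A)\<close> for polynomials \<open>P n\<close>
  converging to \<open>f\<close> uniformly on the spectrum. Real points of the spectrum suffice because a
  self-adjoint operator has real spectrum.
\<close>

definition cfc :: "(real \<Rightarrow> real) \<Rightarrow> ('a::complex_hilbert_space \<Rightarrow> 'a) \<Rightarrow> 'a \<Rightarrow> 'a" where
  "cfc f A = (THE T. bounded_clinear T \<and>
     (\<forall>P. uniform_limit {t. complex_of_real t \<in> spectrum A} (\<lambda>n. poly (P n)) f sequentially
        \<longrightarrow> (\<lambda>n. onorm (\<lambda>x. poly_op (P n) A x - T x)) \<longlonglongrightarrow> 0))"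

text \<open>
  Powers of nonnegative reals with \<open>t\<^sup>0 = 1\<close> for every \<open>t\<close>; the library has \<open>0 powr 0 = 0\<close>.
\<close>

definition rpower :: "real \<Rightarrow> real \<Rightarrow> real" where
  "rpower t s = (if s = 0 then 1 else t powr s)"

definition op_power :: "('a::complex_hilbert_space \<Rightarrow> 'a) \<Rightarrow> real \<Rightarrow> 'a \<Rightarrow> 'a" where
  "op_power A s = cfc (\<lambda>t. rpower t s) A"

end

theory Submission
  imports Defs "HOL-Computational_Algebra.Fundamental_Theorem_Algebra"
begin

text \<open>
  Write \<open>\<phi>\<^sub>A(s) = \<langle>A\<^sup>s x, x\<rangle>\<close> for a unit vector \<open>x\<close>. Moving \<open>A\<^sup>\<alpha>\<close> to the other side of the
  inner product, Cauchy--Schwarz gives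
  \<open>|\<langle>A\<^sup>\<alpha> X B\<^sup>\<alpha> x, x\<rangle>| \<le> \<parallel>X\<parallel> \<parallel>A\<^sup>\<alpha> x\<parallel> \<parallel>B\<^sup>\<alpha> x\<parallel>\<close>, and \<open>\<parallel>A\<^sup>\<alpha> x\<parallel>\<^sup>2 = \<phi>\<^sub>A(2\<alpha>)\<close>.
  As \<open>2\<alpha> \<le> 2 \<le> pr\<close>, the Hoelder--McCarthy inequality (\<open>Hoelder_McCarthy\<close>) bounds
  \<open>\<phi>\<^sub>A(2\<alpha>)\<close> by \<open>\<phi>\<^sub>A(pr)\<close> to the power \<open>2\<alpha> / (pr)\<close>, and the same holds for \<open>B\<close> and \<open>q\<close>.
  Hence \<open>\<parallel>A\<^sup>\<alpha> x\<parallel> \<parallel>B\<^sup>\<alpha> x\<parallel>\<close> is at most \<open>\<phi>\<^sub>A(pr)\<close> to the power \<open>1/p\<close> times \<open>\<phi>\<^sub>B(qr)\<close> to the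
  power \<open>1/q\<close>, all to the power \<open>\<alpha>/r\<close>. By Young's inequality the base is at most
  \<open>\<phi>\<^sub>A(pr)/p + \<phi>\<^sub>B(qr)/q\<close>, which is a value of the quadratic form of the operator on the right
  hand side. It remains to take the supremum over \<open>x\<close> and raise to the power \<open>r\<close>.

  Most of the work is the continuous functional calculus behind \<open>A\<^sup>s\<close>. Its core is positivity
  for polynomials: if \<open>p \<ge> 0\<close> on the real spectrum of a symmetric operator \<open>A\<close>, then
  \<open>p(A) \<ge> 0\<close> (\<open>poly_op_nonneg\<close>). This is derived without spectral measures, from the fact that
  the infimum of the quadratic form of \<open>p(A)\<close> on the unit sphere is a value of \<open>p\<close> on the
  spectrum (\<open>quadratic_form_minimum_in_spectrum\<close>): a real polynomial without zeros there has
  only factors that are bounded below at \<open>A\<close>. Positivity yields the bound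
  \<open>\<parallel>p(A)\<parallel> \<le> sup |p|\<close> over the spectrum, so uniform limits of polynomials define \<open>f(A)\<close>
  (\<open>cfc_limit\<close>). The powers are such limits by the Weierstrass theorem, because the real spectrum
  of a positive operator lies in a compact interval \<open>[0, M]\<close> (\<open>spectrum_positive_op\<close>).
\<close>

section \<open>The inner product\<close>

lemma Re_cinner_self: "Re (cinner x x) = (norm x)\<^sup>2"
  for x :: "'a::complex_hilbert_space"
  using cinner_self_nonneg[of x] by (simp add: norm_eq_sqrt_cinner complex_nonneg_Reals_iff)

lemma Re_cinner_commute: "Re (cinner x y) = Re (cinner y x)"
  for x y :: "'a::complex_hilbert_space"
  using arg_cong[OF cinner_commute[of x y], of Re] by simp

lemma cinner_add_right: "cinner x (y + z) = cinner x y + cinner x z"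
  for x y z :: "'a::complex_hilbert_space"
  by (metis cinner_add_left cinner_commute complex_cnj_add)

lemma cinner_scaleC_right: "cinner x (c *\<^sub>C y) = cnj c * cinner x y"
  for x y :: "'a::complex_hilbert_space"
  by (metis cinner_scaleC_left cinner_commute complex_cnj_mult)

lemma cinner_scaleR_left: "cinner (t *\<^sub>R x) y = t *\<^sub>R cinner x y"
  for x y :: "'a::complex_hilbert_space"
  by (metis cinner_scaleC_left scaleC_of_real scaleR_conv_of_real)

lemma cinner_scaleR_right: "cinner x (t *\<^sub>R y) = t *\<^sub>R cinner x y"
  for x y :: "'a::complex_hilbert_space"
  by (metis cinner_scaleC_right scaleC_of_real scaleR_conv_of_real complex_cnj_complex_of_real)

lemma cinner_diff_left: "cinner (x - y) z = cinner x z - cinner y z"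
  for x y z :: "'a::complex_hilbert_space"
  using cinner_add_left[of "x - y" y z] by simp

lemma cinner_diff_right: "cinner z (x - y) = cinner z x - cinner z y"
  for x y z :: "'a::complex_hilbert_space"
  using cinner_add_right[of z "x - y" y] by simp

lemma cinner_zero [simp]: "cinner 0 x = 0" "cinner x 0 = 0"
  for x :: "'a::complex_hilbert_space"
  using cinner_scaleR_left[of 0 x x] cinner_scaleR_right[of x 0 x] by simp_all

lemmas cinner_algebra = cinner_add_left cinner_add_right cinner_diff_left cinner_diff_right
  cinner_scaleR_left cinner_scaleR_right

lemma norm_scaleC: "norm (c *\<^sub>C x) = cmod c * norm x"
  for x :: "'a::complex_hilbert_space"
proof -
  have "cinner (c *\<^sub>C x) (c *\<^sub>C x) = (c * cnj c) * cinner x x"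
    by (simp add: cinner_scaleC_left cinner_scaleC_right)
  also have "\<dots> = of_real ((cmod c)\<^sup>2) * cinner x x"
    by (simp only: complex_norm_square)
  finally have "(norm (c *\<^sub>C x))\<^sup>2 = (cmod c * norm x)\<^sup>2"
    by (simp add: Re_cinner_self[symmetric] power_mult_distrib)
  then show ?thesis by (simp add: power2_eq_iff_nonneg)
qed

lemma Re_cinner_le_norm: "Re (cinner x y) \<le> norm x * norm y"
  for x y :: "'a::complex_hilbert_space"
proof (cases "x = 0 \<or> y = 0")
  case True
  then show ?thesis by auto
next
  case False
  have "0 \<le> (norm (norm y *\<^sub>R x - norm x *\<^sub>R y))\<^sup>2" by simp
  also have "\<dots> = 2 * ((norm x * norm y) * (norm x * norm y - Re (cinner x y)))"
    unfolding Re_cinner_self[symmetric] cinner_algebra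
    using Re_cinner_commute[of y x]
    by (simp add: Re_cinner_self algebra_simps power2_eq_square)
  finally have "0 \<le> 2 * ((norm x * norm y) * (norm x * norm y - Re (cinner x y)))" .
  moreover have "0 < norm x * norm y" using False by simp
  ultimately show ?thesis unfolding zero_le_mult_iff by linarith
qed

text \<open>
  The bound on real parts becomes Cauchy--Schwarz after rotating the first vector by the phase
  of the inner product.
\<close>

lemma norm_cinner_le: "cmod (cinner x y) \<le> norm x * norm y"
  for x y :: "'a::complex_hilbert_space"
proof (cases "cinner x y = 0")
  case False
  define c where "c = cnj (cinner x y) / cmod (cinner x y)"
  have c: "cmod c = 1" using False by (simp add: c_def norm_divide)
  have "cinner (c *\<^sub>C x) y = cnj (cinner x y) * cinner x y / cmod (cinner x y)"
    by (simp add: cinner_scaleC_left c_def)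
  also have "\<dots> = of_real (cmod (cinner x y))"
    using False by (simp add: complex_norm_square[symmetric] mult.commute[of "cnj _"] power2_eq_square)
  finally have "cmod (cinner x y) = Re (cinner (c *\<^sub>C x) y)" by simp
  also have "\<dots> \<le> norm (c *\<^sub>C x) * norm y" by (rule Re_cinner_le_norm)
  finally show ?thesis by (simp add: norm_scaleC c)
qed simp

lemma bounded_bilinear_cinner:
  "bounded_bilinear (cinner :: 'a::complex_hilbert_space \<Rightarrow> 'a \<Rightarrow> complex)"
  by unfold_locales
    (auto simp: cinner_algebra intro!: exI[of _ 1] norm_cinner_le)

section \<open>Bounded complex linear operators\<close>

lemma bounded_clinear_imp_bounded_linear: "bounded_clinear A \<Longrightarrow> bounded_linear A"
  by (simp add: bounded_clinear_def)

lemma scaleC_scaleR_commute: "c *\<^sub>C (t *\<^sub>R x) = t *\<^sub>R (c *\<^sub>C x)"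
  for x :: "'a::complex_hilbert_space"
  by (metis scaleC_of_real scaleC_scaleC mult.commute)

lemma bounded_clinear_ident: "bounded_clinear (\<lambda>x. x)"
  by (simp add: bounded_clinear_def bounded_linear_ident)

lemma bounded_clinear_zero: "bounded_clinear (\<lambda>x::'a::complex_hilbert_space. 0)"
proof -
  have "c *\<^sub>C (0::'a) = 0" for c
    using scaleC_scaleR_commute[of c 0 "0::'a"] by simp
  then show ?thesis by (simp add: bounded_clinear_def)
qed

lemma bounded_clinear_add:
  "bounded_clinear A \<Longrightarrow> bounded_clinear B \<Longrightarrow> bounded_clinear (\<lambda>x. A x + B x)"
  by (simp add: bounded_clinear_def bounded_linear_add scaleC_add_right)

lemma bounded_clinear_scaleR: "bounded_clinear A \<Longrightarrow> bounded_clinear (\<lambda>x. t *\<^sub>R A x)"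
  by (simp add: bounded_clinear_def bounded_linear_const_scaleR scaleC_scaleR_commute)

lemma bounded_clinear_compose:
  "bounded_clinear A \<Longrightarrow> bounded_clinear B \<Longrightarrow> bounded_clinear (\<lambda>x. A (B x))"
  by (simp add: bounded_clinear_def bounded_linear_compose)

text \<open>
  Polarization over the complex numbers: comparing the quadratic form at \<open>x + y\<close> and at
  \<open>x + \<i>y\<close> shows that an operator with real quadratic form is symmetric.
\<close>

lemma positive_op_symmetric:
  assumes A: "bounded_clinear A" "positive_op A"
  shows "cinner (A x) y = cinner x (A y)"
proof -
  interpret bounded_linear A using A by (simp add: bounded_clinear_imp_bounded_linear)
  have real: "Im (cinner (A z) z) = 0" for z
    using A by (simp add: positive_op_def complex_nonneg_Reals_iff)
  have scaleC: "A (c *\<^sub>C z) = c *\<^sub>C A z" for c z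
    using A by (simp add: bounded_clinear_def)
  have "Im (cinner (A x) y) = - Im (cinner (A y) x)"
    using real[of "x + y"] real[of x] real[of y] by (simp add: add cinner_algebra)
  moreover have "Re (cinner (A x) y) = Re (cinner (A y) x)"
    using real[of "x + \<i> *\<^sub>C y"] real[of x] real[of y]
    by (simp add: add scaleC cinner_algebra cinner_scaleC_left cinner_scaleC_right)
  ultimately have "cinner (A x) y = cnj (cinner (A y) x)"
    by (simp add: complex_eq_iff)
  then show ?thesis using cinner_commute by metis
qed

text \<open>
  The quadratic form of a positive operator controls the operator itself. The inequality is
  the positivity of the form at \<open>x - S x / M\<close>.
\<close>

lemma norm_square_le_quadratic_form:
  fixes S :: "'a::complex_hilbert_space \<Rightarrow> 'a"
  assumes S: "bounded_linear S" and sym: "\<And>x y. cinner (S x) y = cinner x (S y)"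
    and pos: "\<And>x. 0 \<le> Re (cinner (S x) x)"
    and M: "\<And>x. norm (S x) \<le> M * norm x" "0 < M"
  shows "(norm (S x))\<^sup>2 \<le> M * Re (cinner (S x) x)"
proof -
  interpret bounded_linear S by (rule S)
  let ?a = "Re (cinner (S (S x)) (S x))"
  have "?a \<le> norm (S (S x)) * norm (S x)" by (rule Re_cinner_le_norm)
  also have "\<dots> \<le> M * norm (S x) * norm (S x)" by (intro mult_right_mono M) simp
  finally have a: "?a \<le> M * (norm (S x))\<^sup>2" by (simp add: power2_eq_square)
  have "0 \<le> Re (cinner (S (M *\<^sub>R x - S x)) (M *\<^sub>R x - S x))" by (rule pos)
  also have "\<dots> = M\<^sup>2 * Re (cinner (S x) x) - 2 * M * (norm (S x))\<^sup>2 + ?a"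
    using sym[of "S x" x]
    by (simp add: diff scaleR cinner_algebra Re_cinner_self algebra_simps power2_eq_square)
  finally have "M * (norm (S x))\<^sup>2 \<le> M * (M * Re (cinner (S x) x))"
    using a by (simp add: power2_eq_square algebra_simps)
  then show ?thesis using M(2) by simp
qed

section \<open>Invertibility and the location of the spectrum\<close>

lemma not_in_spectrum_imp_bounded_below:
  assumes "complex_of_real t \<notin> spectrum A"
  obtains k where "0 < k" "\<And>x. k * norm x \<le> norm (A x - t *\<^sub>R x)"
proof -
  obtain T where T: "bounded_clinear T" "\<And>x. T (A x - t *\<^sub>R x) = x"
    using assms by (auto simp: spectrum_def scaleC_of_real)
  obtain K where K: "0 < K" "\<And>x. norm (T x) \<le> norm x * K"
    using bounded_linear.pos_bounded[OF bounded_clinear_imp_bounded_linear[OF T(1)]] by blast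
  have "(1 / K) * norm x \<le> norm (A x - t *\<^sub>R x)" for x
    using K(2)[of "A x - t *\<^sub>R x"] K(1) by (simp add: T(2) field_simps)
  with K(1) show thesis by (intro that[of "1 / K"]) auto
qed

text \<open>
  Neumann series in fixed point form: for \<open>\<parallel>C\<parallel> < c\<close> the solution of \<open>(c - C) y = x\<close> is
  the fixed point of the contraction \<open>y \<mapsto> (x + C y) / c\<close>.
\<close>

lemma scalar_minus_contraction_invertible:
  fixes C :: "'a::complex_hilbert_space \<Rightarrow> 'a"
  assumes C: "bounded_clinear C" and k: "\<And>x. norm (C x) \<le> k * norm x" "0 \<le> k" "k < c"
  obtains T where "bounded_clinear T" "\<And>x. T (c *\<^sub>R x - C x) = x" "\<And>x. c *\<^sub>R T x - C (T x) = x"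
proof -
  interpret bounded_linear C using C by (rule bounded_clinear_imp_bounded_linear)
  let ?D = "\<lambda>y. c *\<^sub>R y - C y"
  have c: "0 < c" using k by simp
  have Dadd: "?D (x + y) = ?D x + ?D y" for x y by (simp add: add algebra_simps)
  have DscaleC: "?D (d *\<^sub>C x) = d *\<^sub>C ?D x" for d x
  proof -
    have "d *\<^sub>C ?D x + d *\<^sub>C C x = d *\<^sub>C (c *\<^sub>R x)" by (simp flip: scaleC_add_right)
    moreover have "C (d *\<^sub>C x) = d *\<^sub>C C x" using C by (simp add: bounded_clinear_def)
    ultimately show ?thesis by (simp add: scaleC_scaleR_commute algebra_simps)
  qed
  have below: "(c - k) * norm y \<le> norm (?D y)" for y
    using norm_triangle_ineq2[of "c *\<^sub>R y" "C y"] k(1)[of y] c by (simp add: algebra_simps)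
  have ex: "\<exists>!y. ?D y = x" for x
  proof -
    have "\<exists>!y. (1 / c) *\<^sub>R (x + C y) = y"
    proof (rule banach_fix_type)
      show "0 \<le> k / c" "k / c < 1" using k c by auto
      show "\<forall>y z. dist ((1 / c) *\<^sub>R (x + C y)) ((1 / c) *\<^sub>R (x + C z)) \<le> k / c * dist y z"
        using k(1)[of "_ - _"] c
        by (auto simp: dist_norm diff divide_right_mono simp flip: scaleR_diff_right)
    qed
    moreover have "(1 / c) *\<^sub>R (x + C y) = y \<longleftrightarrow> ?D y = x" for y
    proof -
      have "(1 / c) *\<^sub>R (x + C y) = y \<longleftrightarrow> x + C y = c *\<^sub>R y"
        using c by (simp add: vector_fraction_eq_iff)
      then show ?thesis by (metis add_diff_cancel_right' diff_add_cancel)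
    qed
    ultimately show ?thesis by simp
  qed
  define T where "T x = (THE y. ?D y = x)" for x
  have DT: "?D (T x) = x" for x unfolding T_def by (rule theI'[OF ex])
  have TD: "T (?D y) = y" for y using ex[of "?D y"] DT[of "?D y"] by blast
  have scaleC: "T (d *\<^sub>C x) = d *\<^sub>C T x" for d x by (metis DscaleC DT TD)
  have "bounded_linear T"
  proof (rule bounded_linear_intro)
    show "T (x + y) = T x + T y" for x y by (metis Dadd DT TD)
    show "T (t *\<^sub>R x) = t *\<^sub>R T x" for t x
      using scaleC[of "complex_of_real t" x] by (simp add: scaleC_of_real)
    show "norm (T x) \<le> norm x * (1 / (c - k))" for x
      using below[of "T x"] k by (simp add: DT field_simps)
  qed
  then have "bounded_clinear T" by (simp add: bounded_clinear_def scaleC)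
  from that[OF this TD DT] show thesis .
qed

text \<open>
  Above \<open>M\<close> the Neumann series applies to \<open>A\<close>; below \<open>0\<close> it applies to \<open>M - A\<close>,
  which also has norm at most \<open>M\<close> because \<open>0 \<le> A \<le> M\<close>.
\<close>

lemma spectrum_positive_op:
  assumes A: "bounded_clinear A" "positive_op A"
    and M: "0 < M" "\<And>x. norm (A x) \<le> M * norm x"
  shows "{t. complex_of_real t \<in> spectrum A} \<subseteq> {0..M}"
proof
  fix t assume "t \<in> {t. complex_of_real t \<in> spectrum A}"
  then have t: "complex_of_real t \<in> spectrum A" by simp
  interpret bounded_linear A using A by (simp add: bounded_clinear_imp_bounded_linear)
  have pos: "0 \<le> Re (cinner (A x) x)" for x
    using A by (simp add: positive_op_def complex_nonneg_Reals_iff)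
  show "t \<in> {0..M}"
  proof (rule ccontr)
    assume "t \<notin> {0..M}"
    then consider "M < t" | "t < 0" by fastforce
    then show False
    proof cases
      case 1
      obtain T where T: "bounded_clinear T" "\<And>x. T (t *\<^sub>R x - A x) = x" "\<And>x. t *\<^sub>R T x - A (T x) = x"
        using scalar_minus_contraction_invertible[OF A(1) M(2), of t] M(1) 1
        by (metis less_imp_le)
      interpret T: bounded_linear T using T(1) by (rule bounded_clinear_imp_bounded_linear)
      have "bounded_clinear (\<lambda>x. (-1) *\<^sub>R T x)" using T(1) by (rule bounded_clinear_scaleR)
      moreover have "(-1) *\<^sub>R T (A x - t *\<^sub>R x) = x" for x
        using T(2)[of x] by (simp flip: T.neg)
      moreover have "A ((-1) *\<^sub>R T x) - t *\<^sub>R ((-1) *\<^sub>R T x) = x" for x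
        using T(3)[of x] by (simp add: neg)
      ultimately show False using t by (auto simp: spectrum_def scaleC_of_real)
    next
      case 2
      let ?C = "\<lambda>x. M *\<^sub>R x + (-1) *\<^sub>R A x"
      have "norm (?C x) \<le> M * norm x" for x
      proof -
        have "(norm (A x))\<^sup>2 \<le> M * Re (cinner (A x) x)"
          by (rule norm_square_le_quadratic_form[OF bounded_linear_axioms
                positive_op_symmetric[OF A] pos M(2) M(1)])
        moreover have "0 \<le> M * Re (cinner (A x) x)" using M(1) pos by simp
        moreover have "(norm (?C x))\<^sup>2 = (M * norm x)\<^sup>2 - 2 * (M * Re (cinner (A x) x)) + (norm (A x))\<^sup>2"
          unfolding Re_cinner_self[symmetric] power_mult_distrib
          using Re_cinner_commute[of "A x" x]
          by (simp add: cinner_algebra algebra_simps power2_eq_square)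
        ultimately have "(norm (?C x))\<^sup>2 \<le> (M * norm x)\<^sup>2" by linarith
        then show ?thesis using M(1) by (simp add: power2_le_iff_abs_le abs_mult)
      qed
      moreover have "bounded_clinear ?C"
        by (intro bounded_clinear_add bounded_clinear_scaleR bounded_clinear_ident A)
      ultimately obtain T where T: "bounded_clinear T" "\<And>x. T ((M - t) *\<^sub>R x - ?C x) = x"
        "\<And>x. (M - t) *\<^sub>R T x - ?C (T x) = x"
        using scalar_minus_contraction_invertible[of ?C M "M - t"] M(1) 2
        by (smt (verit, best))
      then have "T (A x - t *\<^sub>R x) = x" "A (T x) - t *\<^sub>R T x = x" for x
        by (simp_all add: algebra_simps)
      with T(1) show False using t by (auto simp: spectrum_def scaleC_of_real)
    qed
  qed
qed

section \<open>The polynomial calculus\<close>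

lemma poly_op_eq_sum:
  assumes "degree p \<le> n"
  shows "poly_op p A x = (\<Sum>i\<le>n. coeff p i *\<^sub>R (A ^^ i) x)"
  unfolding poly_op_def using assms
  by (intro sum.mono_neutral_left) (auto simp: coeff_eq_0)

lemma poly_op_0 [simp]: "poly_op 0 A x = 0"
  by (simp add: poly_op_def)

lemma poly_op_pCons:
  assumes "bounded_clinear A"
  shows "poly_op (pCons a p) A x = a *\<^sub>R x + A (poly_op p A x)"
proof -
  interpret bounded_linear A using assms by (rule bounded_clinear_imp_bounded_linear)
  have "poly_op (pCons a p) A x = (\<Sum>i\<le>Suc (degree p). coeff (pCons a p) i *\<^sub>R (A ^^ i) x)"
    by (intro poly_op_eq_sum) (simp add: degree_pCons_le)
  also have "\<dots> = a *\<^sub>R x + A (poly_op p A x)"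
    by (subst sum.atMost_Suc_shift) (simp add: poly_op_def sum scaleR)
  finally show ?thesis .
qed

text \<open>
  The quadratic factor belongs to a complex root \<open>z = a + b\<i>\<close>: it vanishes at \<open>z\<close>, so the
  remainder of \<open>p\<close> modulo it is a real polynomial of degree at most one with the non-real
  root \<open>z\<close>, hence \<open>0\<close>.
\<close>

lemma real_poly_linear_or_quadratic_factor:
  fixes p :: "real poly"
  assumes "0 < degree p"
  obtains (linear) a where "[:- a, 1:] dvd p"
    | (quadratic) a b where "b \<noteq> 0" "[:a\<^sup>2 + b\<^sup>2, - 2 * a, 1:] dvd p"
proof -
  let ?c = "map_poly of_real :: real poly \<Rightarrow> complex poly"
  have "\<not> constant (poly (?c p))"
    using assms by (simp add: constant_degree degree_map_poly)
  then obtain z where z: "poly (?c p) z = 0"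
    using fundamental_theorem_of_algebra by blast
  show thesis
  proof (cases "Im z = 0")
    case True
    then have "z = of_real (Re z)" by (simp add: complex_eq_iff)
    moreover have "poly (?c p) (of_real t) = of_real (poly p t)" for t
      by (induction p) (simp_all add: map_poly_pCons)
    ultimately have "poly p (Re z) = 0" using z by (metis of_real_eq_0_iff)
    then have "[:- Re z, 1:] dvd p" by (simp add: poly_eq_0_iff_dvd)
    then show thesis by (rule linear)
  next
    case False
    let ?d = "[:(Re z)\<^sup>2 + (Im z)\<^sup>2, - 2 * Re z, 1:]"
    obtain q r where pqr: "p = ?d * q + r" and r: "r = 0 \<or> degree r < degree ?d"
    proof
      show "p = ?d * (p div ?d) + p mod ?d" by (rule mult_div_mod_eq[symmetric])
      show "p mod ?d = 0 \<or> degree (p mod ?d) < degree ?d" by (rule degree_mod_less) simp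
    qed
    have hom: "?c (f * g + h) = ?c f * ?c g + ?c h" for f g h
      by (intro poly_eqI) (simp add: coeff_map_poly coeff_mult)
    have d0: "poly (?c ?d) z = 0"
      by (simp add: map_poly_pCons complex_eq_iff power2_eq_square algebra_simps)
    obtain r0 r1 where r01: "r = [:r0, r1:]"
    proof (cases r rule: pCons_cases)
      case (pCons r0 r')
      then have "degree r' = 0" using r by (auto split: if_splits)
      then obtain r1 where "r' = [:r1:]" by (rule degree_eq_zeroE)
      with pCons show thesis by (intro that) simp
    qed
    have "poly (?c r) z = 0" using z hom[of ?d q r] d0 by (simp add: pqr)
    then have "r1 = 0" "r0 = 0"
      using False by (auto simp: r01 map_poly_pCons complex_eq_iff)
    then have "p = ?d * q" using pqr by (simp add: r01)
    then have "?d dvd p" by (rule dvdI)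
    with False show thesis by (rule quadratic)
  qed
qed

locale symmetric_operator =
  fixes A :: "'a::complex_hilbert_space \<Rightarrow> 'a"
  assumes clinear: "bounded_clinear A"
    and symmetric: "cinner (A x) y = cinner x (A y)"
begin

abbreviation real_spectrum :: "real set" where
  "real_spectrum \<equiv> {t. complex_of_real t \<in> spectrum A}"

sublocale bounded_linear A
  using clinear by (rule bounded_clinear_imp_bounded_linear)

lemmas poly_op_pCons = poly_op_pCons[OF clinear]

lemma poly_op_const: "poly_op [:c:] A x = c *\<^sub>R x"
  by (simp add: poly_op_pCons zero)

lemma poly_op_add: "poly_op (p + q) A x = poly_op p A x + poly_op q A x"
  by (induction p q rule: poly_induct2) (simp_all add: poly_op_pCons add algebra_simps)

lemma poly_op_smult: "poly_op (smult c p) A x = c *\<^sub>R poly_op p A x"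
  by (induction p) (simp_all add: poly_op_pCons scaleR algebra_simps)

lemma poly_op_diff: "poly_op (p - q) A x = poly_op p A x - poly_op q A x"
  using poly_op_add[of "p - q" q x] by simp

lemma poly_op_mult: "poly_op (p * q) A x = poly_op p A (poly_op q A x)"
  by (induction p) (simp_all add: poly_op_pCons poly_op_add poly_op_smult)

lemma poly_op_commute: "poly_op p A (A x) = A (poly_op p A x)"
  by (induction p) (simp_all add: poly_op_pCons add scaleR zero)

lemma poly_op_clinear: "bounded_clinear (poly_op p A)"
proof (induction p)
  case 0
  then show ?case by (simp add: bounded_clinear_zero poly_op_0 [abs_def])
next
  case (pCons a p)
  have "poly_op (pCons a p) A = (\<lambda>x. a *\<^sub>R x + A (poly_op p A x))"
    by (simp add: poly_op_pCons fun_eq_iff)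
  then show ?case
    using bounded_clinear_add[OF bounded_clinear_scaleR[OF bounded_clinear_ident]
        bounded_clinear_compose[OF clinear pCons(2)]] by simp
qed

lemmas poly_op_linear = bounded_clinear_imp_bounded_linear[OF poly_op_clinear]

lemma poly_op_symmetric: "cinner (poly_op p A x) y = cinner x (poly_op p A y)"
  by (induction p arbitrary: x y)
    (simp_all add: poly_op_pCons cinner_algebra symmetric poly_op_commute)

text \<open>
  A polynomial without zeros in the real spectrum is bounded below at \<open>A\<close>, because its
  irreducible real factors are. A linear factor has its root outside the spectrum, so it is
  invertible. A quadratic factor is \<open>(A - a)\<^sup>2 + b\<^sup>2\<close> with \<open>b \<noteq> 0\<close>, so its
  quadratic form is at least \<open>b\<^sup>2\<close>; in this way non-real points of the spectrum never enter.
\<close>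

lemma poly_op_bounded_below:
  assumes "p \<noteq> 0" "\<And>t. t \<in> real_spectrum \<Longrightarrow> poly p t \<noteq> 0"
  shows "\<exists>k>0. \<forall>x. k * norm x \<le> norm (poly_op p A x)"
  using assms
proof (induction "degree p" arbitrary: p rule: less_induct)
  case less
  have factor: "\<exists>k>0. \<forall>x. k * norm x \<le> norm (poly_op p A x)"
    if dvd: "d dvd p" and deg: "0 < degree d"
      and k: "0 < k" "\<And>x. k * norm x \<le> norm (poly_op d A x)" for d k
  proof -
    from dvd obtain q where p: "p = d * q" by (auto elim: dvdE)
    with less.prems have nz: "q \<noteq> 0" "d \<noteq> 0" by auto
    with p deg have "degree q < degree p" by (simp add: degree_mult_eq)
    then obtain l where l: "0 < l" "\<And>x. l * norm x \<le> norm (poly_op q A x)"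
      using less.hyps[of q] less.prems nz by (auto simp: p)
    have "k * l * norm x \<le> norm (poly_op p A x)" for x
    proof -
      have "k * (l * norm x) \<le> k * norm (poly_op q A x)"
        using l(2) k(1) by (intro mult_left_mono) auto
      also have "\<dots> \<le> norm (poly_op p A x)" by (simp add: p poly_op_mult k(2))
      finally show ?thesis by (simp add: mult.assoc)
    qed
    with k(1) l(1) show ?thesis by (intro exI[of _ "k * l"]) auto
  qed
  show ?case
  proof (cases "degree p = 0")
    case True
    then obtain c where p: "p = [:c:]" by (rule degree_eq_zeroE)
    with less.prems show ?thesis by (intro exI[of _ "\<bar>c\<bar>"]) (auto simp: poly_op_const)
  next
    case False
    then have "0 < degree p" by simp
    then show ?thesis
    proof (cases rule: real_poly_linear_or_quadratic_factor)
      case (linear a)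
      then have "poly p a = 0" by (simp add: poly_eq_0_iff_dvd)
      with less.prems have "complex_of_real a \<notin> spectrum A" by auto
      then obtain k where k: "0 < k" "\<And>x. k * norm x \<le> norm (A x - a *\<^sub>R x)"
        by (rule not_in_spectrum_imp_bounded_below) blast
      have "poly_op [:- a, 1:] A x = A x - a *\<^sub>R x" for x
        by (simp add: poly_op_pCons zero)
      with factor[OF linear _ k(1)] k(2) show ?thesis by simp
    next
      case (quadratic a b)
      let ?d = "[:a\<^sup>2 + b\<^sup>2, - 2 * a, 1:]"
      have "b\<^sup>2 * norm x \<le> norm (poly_op ?d A x)" for x
      proof (cases "x = 0")
        case False
        let ?y = "A x - a *\<^sub>R x"
        have two: "(2 * a) *\<^sub>R A x = a *\<^sub>R A x + a *\<^sub>R A x"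
          by (metis mult_2 scaleR_left_distrib)
        have "poly_op ?d A x = A ?y - a *\<^sub>R ?y + b\<^sup>2 *\<^sub>R x"
          by (simp add: poly_op_pCons zero diff scaleR add two scaleR_left_distrib scaleR_diff_right power2_eq_square)
        moreover have "cinner (A ?y - a *\<^sub>R ?y) x = cinner ?y ?y"
          by (simp add: cinner_algebra symmetric diff scaleR algebra_simps)
        ultimately have "Re (cinner (poly_op ?d A x) x) = (norm ?y)\<^sup>2 + b\<^sup>2 * (norm x)\<^sup>2"
          by (simp only: cinner_add_left cinner_scaleR_left) (simp add: Re_cinner_self)
        then have "b\<^sup>2 * (norm x)\<^sup>2 \<le> Re (cinner (poly_op ?d A x) x)" by simp
        also have "\<dots> \<le> norm (poly_op ?d A x) * norm x" by (rule Re_cinner_le_norm)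
        finally show ?thesis using False by (simp add: power2_eq_square[of "norm x"])
      qed simp
      with factor[OF quadratic(2), of "b\<^sup>2"] quadratic(1) show ?thesis by simp
    qed
  qed
qed

text \<open>
  The infimum \<open>m\<close> of the quadratic form of \<open>p(A)\<close> on the unit sphere is a value of \<open>p\<close> on the
  spectrum. Otherwise \<open>p(A) - m\<close> would be a positive operator that is bounded below, and then
  its quadratic form would stay away from \<open>0\<close> on the unit sphere. For a constant \<open>p\<close> the
  polynomial \<open>p - m\<close> is \<open>0\<close>, and the argument says nothing.
\<close>

lemma quadratic_form_minimum_in_spectrum:
  assumes p: "0 < degree p" and u: "norm (u::'a) = 1"
  shows "\<exists>t\<in>real_spectrum. \<forall>x. poly p t * (norm x)\<^sup>2 \<le> Re (cinner (poly_op p A x) x)"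
proof -
  let ?Q = "\<lambda>x. Re (cinner (poly_op p A x) x)"
  interpret P: bounded_linear "poly_op p A" by (rule poly_op_linear)
  define m where "m = Inf (?Q ` {x. norm x = 1})"
  obtain K where K: "\<And>x. norm (poly_op p A x) \<le> norm x * K" using P.bounded by blast
  have "- K \<le> ?Q x" if "norm x = 1" for x
    using Re_cinner_le_norm[of "- poly_op p A x" x] K[of x] that
      cinner_scaleR_left[of "-1" "poly_op p A x" x] by simp
  then have bdd: "bdd_below (?Q ` {x. norm x = 1})" by (auto intro!: bdd_belowI2)
  have m_unit: "m \<le> ?Q x" if "norm x = 1" for x
    unfolding m_def using that by (intro cInf_lower bdd) auto
  have m_le: "m * (norm x)\<^sup>2 \<le> ?Q x" for x
  proof (cases "x = 0")
    case False
    have "m \<le> ?Q ((1 / norm x) *\<^sub>R x)" by (rule m_unit) (use False in simp)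
    also have "\<dots> = ?Q x / (norm x)\<^sup>2"
      by (simp add: P.scaleR cinner_algebra power2_eq_square)
    finally show ?thesis using False by (simp add: field_simps)
  qed (simp add: P.zero)
  have "\<exists>t\<in>real_spectrum. poly p t = m"
  proof (rule ccontr)
    assume "\<not> ?thesis"
    then have ne: "poly p t \<noteq> m" if "t \<in> real_spectrum" for t using that by auto
    let ?S = "poly_op (p - [:m:]) A"
    have S: "?S x = poly_op p A x - m *\<^sub>R x" for x by (simp add: poly_op_diff poly_op_const)
    have QS: "Re (cinner (?S x) x) = ?Q x - m * (norm x)\<^sup>2" for x
      by (simp add: S cinner_algebra Re_cinner_self)
    have "p - [:m:] \<noteq> 0" using p by auto
    then obtain k where k: "0 < k" "\<And>x. k * norm x \<le> norm (?S x)"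
      using poly_op_bounded_below[of "p - [:m:]"] ne by auto
    obtain M where M: "0 < M" "\<And>x. norm (?S x) \<le> norm x * M"
      using bounded_linear.pos_bounded[OF poly_op_linear] by blast
    have "m + k\<^sup>2 / M \<le> ?Q x" if "norm x = 1" for x
    proof -
      have "k\<^sup>2 \<le> (norm (?S x))\<^sup>2"
        using k(2)[of x] k(1) that by (intro power_mono) auto
      also have "\<dots> \<le> M * Re (cinner (?S x) x)"
      proof (rule norm_square_le_quadratic_form[OF poly_op_linear poly_op_symmetric _ _ M(1)])
        show "0 \<le> Re (cinner (?S y) y)" for y using m_le[of y] by (simp add: QS)
        show "norm (?S y) \<le> M * norm y" for y using M(2)[of y] by (simp add: mult.commute)
      qed
      also have "\<dots> = M * (?Q x - m)" by (simp add: QS that)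
      finally show ?thesis using M(1) by (simp add: field_simps)
    qed
    then have "m + k\<^sup>2 / M \<le> Inf (?Q ` {x. norm x = 1})"
      using u by (intro cInf_greatest) auto
    then have "m + k\<^sup>2 / M \<le> m" unfolding m_def[symmetric] .
    with k(1) M(1) show False by (simp add: field_simps)
  qed
  with m_le show ?thesis by auto
qed

text \<open>
  For a constant polynomial the previous lemma is applied to the identity polynomial instead,
  to know that the spectrum has a point at all.
\<close>

lemma poly_op_nonneg:
  assumes "\<And>t. t \<in> real_spectrum \<Longrightarrow> 0 \<le> poly p t"
  shows "0 \<le> Re (cinner (poly_op p A x) x)"
proof (cases "x = 0")
  case True
  then show ?thesis by simp
next
  case False
  define u where "u = (1 / norm x) *\<^sub>R x"
  have u: "norm u = 1" using False by (simp add: u_def)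
  show ?thesis
  proof (cases "degree p = 0")
    case True
    then obtain c where c: "p = [:c:]" by (rule degree_eq_zeroE)
    have "real_spectrum \<noteq> {}"
      using quadratic_form_minimum_in_spectrum[of "[:0, 1:]", OF _ u] by auto
    with assms have "0 \<le> c" by (auto simp: c)
    then show ?thesis by (simp add: c poly_op_const cinner_algebra Re_cinner_self)
  next
    case False
    then obtain t where "t \<in> real_spectrum"
      and t: "poly p t * (norm x)\<^sup>2 \<le> Re (cinner (poly_op p A x) x)"
      using quadratic_form_minimum_in_spectrum[of p, OF _ u] by auto
    then have "0 \<le> poly p t * (norm x)\<^sup>2" using assms by simp
    with t show ?thesis by linarith
  qed
qed

lemma cinner_poly_op_square:
  "Re (cinner (poly_op (p * p) A x) x) = (norm (poly_op p A x))\<^sup>2"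
  by (simp add: poly_op_mult poly_op_symmetric[of p "poly_op p A x"] Re_cinner_self)

text \<open>
  Positivity of the polynomial \<open>e\<^sup>2 - p\<^sup>2\<close>, read off at \<open>x\<close>.
\<close>

lemma norm_poly_op_le:
  assumes e: "0 \<le> e" and p: "\<And>t. t \<in> real_spectrum \<Longrightarrow> \<bar>poly p t\<bar> \<le> e"
  shows "norm (poly_op p A x) \<le> e * norm x"
proof -
  have "0 \<le> Re (cinner (poly_op ([:e\<^sup>2:] - p * p) A x) x)"
  proof (rule poly_op_nonneg)
    fix t assume "t \<in> real_spectrum"
    from power_mono[OF p[OF this], of 2] show "0 \<le> poly ([:e\<^sup>2:] - p * p) t"
      by (simp add: power2_eq_square)
  qed
  also have "\<dots> = (e * norm x)\<^sup>2 - (norm (poly_op p A x))\<^sup>2"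
    by (simp add: poly_op_diff poly_op_const cinner_algebra cinner_poly_op_square Re_cinner_self
        power_mult_distrib)
  finally show ?thesis using e by (simp add: power2_le_iff_abs_le abs_mult)
qed

end

section \<open>The continuous functional calculus\<close>

context symmetric_operator
begin

lemma poly_op_uniform_limit_close:
  assumes P: "uniform_limit real_spectrum (\<lambda>n. poly (P n)) f sequentially"
    and Q: "uniform_limit real_spectrum (\<lambda>n. poly (Q n)) f sequentially"
    and e: "0 < e"
  shows "\<exists>N. \<forall>m\<ge>N. \<forall>n\<ge>N. \<forall>x. norm (poly_op (P m) A x - poly_op (Q n) A x) \<le> e * norm x"
proof -
  have "0 < e / 2" using e by simp
  then obtain N1 N2 where
    N1: "\<And>n t. N1 \<le> n \<Longrightarrow> t \<in> real_spectrum \<Longrightarrow> dist (poly (P n) t) (f t) < e / 2" and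
    N2: "\<And>n t. N2 \<le> n \<Longrightarrow> t \<in> real_spectrum \<Longrightarrow> dist (poly (Q n) t) (f t) < e / 2"
    using P Q unfolding uniform_limit_sequentially_iff by meson
  have "norm (poly_op (P m - Q n) A x) \<le> e * norm x"
    if "max N1 N2 \<le> m" "max N1 N2 \<le> n" for m n x
  proof (rule norm_poly_op_le)
    fix t assume "t \<in> real_spectrum"
    then show "\<bar>poly (P m - Q n) t\<bar> \<le> e"
      using N1[of m t] N2[of n t] that by (simp add: dist_real_def abs_if split: if_splits)
  qed (use e in simp)
  then show ?thesis by (intro exI[of _ "max N1 N2"]) (auto simp: poly_op_diff)
qed

lemma poly_op_uniform_limit_exists:
  assumes P: "uniform_limit real_spectrum (\<lambda>n. poly (P n)) f sequentially"
  obtains T where "bounded_clinear T"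
    "\<And>Q. uniform_limit real_spectrum (\<lambda>n. poly (Q n)) f sequentially \<Longrightarrow>
      (\<lambda>n. onorm (\<lambda>x. poly_op (Q n) A x - T x)) \<longlonglongrightarrow> 0"
proof -
  have "Cauchy (\<lambda>n. poly_op (P n) A x)" for x
  proof (rule metric_CauchyI)
    fix e :: real assume e: "0 < e"
    define d where "d = e / (norm x + 1)"
    have pos: "0 < norm x + 1" by (simp add: add_nonneg_pos)
    then have d: "0 < d" using e by (simp add: d_def)
    obtain N where "\<forall>m\<ge>N. \<forall>n\<ge>N. \<forall>x. norm (poly_op (P m) A x - poly_op (P n) A x) \<le> d * norm x"
      using poly_op_uniform_limit_close[OF P P d] by blast
    moreover have "d * norm x < e" using pos e by (simp add: d_def field_simps)
    ultimately show "\<exists>N. \<forall>m\<ge>N. \<forall>n\<ge>N. dist (poly_op (P m) A x) (poly_op (P n) A x) < e"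
      unfolding dist_norm by (meson le_less_trans)
  qed
  then have conv: "convergent (\<lambda>n. poly_op (P n) A x)" for x by (simp add: Cauchy_convergent_iff)
  define T where "T x = lim (\<lambda>n. poly_op (P n) A x)" for x
  have T: "(\<lambda>n. poly_op (P n) A x) \<longlonglongrightarrow> T x" for x
    using conv[of x] by (simp add: T_def convergent_LIMSEQ_iff)
  have close: "\<exists>N. \<forall>n\<ge>N. \<forall>x. norm (poly_op (Q n) A x - T x) \<le> e * norm x"
    if Q: "uniform_limit real_spectrum (\<lambda>n. poly (Q n)) f sequentially" and e: "0 < e" for Q e
  proof -
    obtain N where N: "\<And>m n x. N \<le> m \<Longrightarrow> N \<le> n \<Longrightarrow>
        norm (poly_op (Q m) A x - poly_op (P n) A x) \<le> e * norm x"
      using poly_op_uniform_limit_close[OF Q P e] by blast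
    have "norm (poly_op (Q m) A x - T x) \<le> e * norm x" if "N \<le> m" for m x
    proof (rule tendsto_upperbound)
      show "(\<lambda>n. norm (poly_op (Q m) A x - poly_op (P n) A x)) \<longlonglongrightarrow> norm (poly_op (Q m) A x - T x)"
        by (intro tendsto_intros T)
      show "\<forall>\<^sub>F n in sequentially. norm (poly_op (Q m) A x - poly_op (P n) A x) \<le> e * norm x"
        using N[OF that] by (auto simp: eventually_sequentially)
    qed simp
    then show ?thesis by blast
  qed
  have lin: "bounded_linear (poly_op p A)" for p by (rule poly_op_linear)
  have "bounded_linear T"
  proof -
    obtain N where N: "\<And>x. norm (poly_op (P N) A x - T x) \<le> 1 * norm x"
      using close[OF P, of 1] by auto
    obtain K where K: "\<And>x. norm (poly_op (P N) A x) \<le> norm x * K"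
      using bounded_linear.bounded[OF lin] by blast
    show ?thesis
    proof (rule bounded_linear_intro)
      show "T (x + y) = T x + T y" for x y
        using T[of "x + y"] tendsto_add[OF T[of x] T[of y]]
        by (simp add: linear_simps(1)[OF lin] LIMSEQ_unique)
      show "T (t *\<^sub>R x) = t *\<^sub>R T x" for t x
        using T[of "t *\<^sub>R x"] tendsto_scaleR[OF tendsto_const T[of x], of t]
        by (simp add: linear_simps(5)[OF lin] LIMSEQ_unique)
      show "norm (T x) \<le> norm x * (K + 1)" for x
        using norm_triangle_sub[of "T x" "poly_op (P N) A x"] N[of x] K[of x]
        by (simp add: norm_minus_commute algebra_simps)
    qed
  qed
  moreover have "T (c *\<^sub>C x) = c *\<^sub>C T x" for c x
  proof -
    have "bounded_linear (\<lambda>y::'a. c *\<^sub>C y)"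
      by (intro bounded_linear_intro[where K = "cmod c"])
        (simp_all add: scaleC_add_right scaleC_scaleR_commute norm_scaleC)
    from bounded_linear.tendsto[OF this T[of x]] have "(\<lambda>n. poly_op (P n) A (c *\<^sub>C x)) \<longlonglongrightarrow> c *\<^sub>C T x"
      using poly_op_clinear by (simp add: bounded_clinear_def)
    with T show ?thesis by (rule LIMSEQ_unique)
  qed
  ultimately have "bounded_clinear T" by (simp add: bounded_clinear_def)
  moreover have "(\<lambda>n. onorm (\<lambda>x. poly_op (Q n) A x - T x)) \<longlonglongrightarrow> 0"
    if Q: "uniform_limit real_spectrum (\<lambda>n. poly (Q n)) f sequentially" for Q
  proof (rule metric_LIMSEQ_I)
    fix e :: real assume e: "0 < e"
    have nonneg: "0 \<le> onorm (\<lambda>x. poly_op (Q n) A x - T x)" for n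
      using \<open>bounded_linear T\<close> lin by (intro onorm_pos_le bounded_linear_sub)
    obtain N where "\<And>n x. N \<le> n \<Longrightarrow> norm (poly_op (Q n) A x - T x) \<le> e / 2 * norm x"
      using close[OF Q, of "e / 2"] e by auto
    then have "onorm (\<lambda>x. poly_op (Q n) A x - T x) \<le> e / 2" if "N \<le> n" for n
      using that e by (intro onorm_bound) auto
    then show "\<exists>N. \<forall>n\<ge>N. dist (onorm (\<lambda>x. poly_op (Q n) A x - T x)) 0 < e"
      using e nonneg by (intro exI[of _ N]) (fastforce simp: dist_real_def)
  qed
  ultimately show thesis by (rule that)
qed

lemma onorm_limit_imp_pointwise_limit:
  assumes T: "bounded_clinear T"
    and lim: "(\<lambda>n. onorm (\<lambda>x. poly_op (P n) A x - T x)) \<longlonglongrightarrow> 0"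
  shows "(\<lambda>n. poly_op (P n) A x) \<longlonglongrightarrow> T x"
proof -
  have "bounded_linear (\<lambda>x. poly_op (P n) A x - T x)" for n
    using T by (intro bounded_linear_sub poly_op_linear bounded_clinear_imp_bounded_linear)
  then have le: "norm (poly_op (P n) A x - T x) \<le> onorm (\<lambda>x. poly_op (P n) A x - T x) * norm x" for n
    by (rule onorm)
  have "(\<lambda>n. onorm (\<lambda>x. poly_op (P n) A x - T x) * norm x) \<longlonglongrightarrow> 0"
    using tendsto_mult_right[OF lim, of "norm x"] by simp
  then have "(\<lambda>n. poly_op (P n) A x - T x) \<longlonglongrightarrow> 0"
    by (rule Lim_null_comparison[rotated]) (use le in \<open>simp add: always_eventually\<close>)
  then show ?thesis by (simp add: LIM_zero_iff)
qed

text \<open>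
  Whenever \<open>f\<close> is a uniform limit of polynomials on the spectrum, the description that defines
  \<open>cfc f A\<close> has exactly one solution. From here on the calculus is used only through strong
  limits of polynomials.
\<close>

lemma cfc_limit:
  assumes P: "uniform_limit real_spectrum (\<lambda>n. poly (P n)) f sequentially"
  shows "bounded_clinear (cfc f A)" and "(\<lambda>n. poly_op (P n) A x) \<longlonglongrightarrow> cfc f A x"
proof -
  let ?C = "\<lambda>T. bounded_clinear T \<and>
     (\<forall>Q. uniform_limit real_spectrum (\<lambda>n. poly (Q n)) f sequentially
        \<longrightarrow> (\<lambda>n. onorm (\<lambda>x. poly_op (Q n) A x - T x)) \<longlonglongrightarrow> 0)"
  obtain T where T: "?C T" by (rule poly_op_uniform_limit_exists[OF P]) blast
  have pointwise: "(\<lambda>n. poly_op (P n) A x) \<longlonglongrightarrow> S x" if "?C S" for S x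
    using that P by (intro onorm_limit_imp_pointwise_limit) auto
  have "S = T" if "?C S" for S
    using LIMSEQ_unique[OF pointwise[OF that] pointwise[OF T]] by (simp add: fun_eq_iff)
  with T have C: "?C (cfc f A)" unfolding cfc_def by (rule theI)
  from C show "bounded_clinear (cfc f A)" by (rule conjunct1)
  from C show "(\<lambda>n. poly_op (P n) A x) \<longlonglongrightarrow> cfc f A x" by (rule pointwise)
qed

lemma cfc_one: "cfc (\<lambda>_. 1) A x = x"
proof -
  have "uniform_limit real_spectrum (\<lambda>n. poly [:1:]) (\<lambda>_. 1) sequentially"
    by (intro uniform_limitI) simp
  from cfc_limit(2)[OF this, of x] show ?thesis
    by (simp add: poly_op_const LIMSEQ_const_iff)
qed

lemma cfc_symmetric:
  assumes P: "uniform_limit real_spectrum (\<lambda>n. poly (P n)) f sequentially"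
  shows "cinner (cfc f A x) y = cinner x (cfc f A y)"
proof -
  note lim = cfc_limit(2)[OF P]
  have "(\<lambda>n. cinner (poly_op (P n) A x) y) \<longlonglongrightarrow> cinner (cfc f A x) y"
    by (intro bounded_bilinear.tendsto[OF bounded_bilinear_cinner] tendsto_const lim)
  moreover have "(\<lambda>n. cinner x (poly_op (P n) A y)) \<longlonglongrightarrow> cinner x (cfc f A y)"
    by (intro bounded_bilinear.tendsto[OF bounded_bilinear_cinner] tendsto_const lim)
  ultimately show ?thesis by (simp add: poly_op_symmetric LIMSEQ_unique)
qed

lemma cfc_quadratic_form_limit:
  assumes P: "uniform_limit real_spectrum (\<lambda>n. poly (P n)) f sequentially"
  shows "(\<lambda>n. Re (cinner (poly_op (P n) A x) x)) \<longlonglongrightarrow> Re (cinner (cfc f A x) x)"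
  by (intro tendsto_Re bounded_bilinear.tendsto[OF bounded_bilinear_cinner] tendsto_const
      cfc_limit(2)[OF P])

text \<open>
  The limit of \<open>\<parallel>P n(A) x\<parallel>\<^sup>2 = \<langle>(P n)\<^sup>2(A) x, x\<rangle>\<close>. Boundedness of \<open>f\<close> makes the
  squares of the polynomials converge uniformly.
\<close>

lemma norm_cfc_square:
  assumes P: "uniform_limit real_spectrum (\<lambda>n. poly (P n)) f sequentially"
    and bdd: "bounded (f ` real_spectrum)"
  shows "(norm (cfc f A x))\<^sup>2 = Re (cinner (cfc (\<lambda>t. f t * f t) A x) x)"
proof -
  have "uniform_limit real_spectrum (\<lambda>n. poly (P n * P n)) (\<lambda>t. f t * f t) sequentially"
    unfolding poly_mult by (rule uniform_lim_mult[OF P P bdd bdd])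
  from cfc_quadratic_form_limit[OF this, of x]
  have "(\<lambda>n. (norm (poly_op (P n) A x))\<^sup>2) \<longlonglongrightarrow> Re (cinner (cfc (\<lambda>t. f t * f t) A x) x)"
    by (simp add: cinner_poly_op_square)
  moreover have "(\<lambda>n. (norm (poly_op (P n) A x))\<^sup>2) \<longlonglongrightarrow> (norm (cfc f A x))\<^sup>2"
    by (intro tendsto_intros cfc_limit(2)[OF P])
  ultimately show ?thesis using LIMSEQ_unique by blast
qed

text \<open>
  Positivity of the calculus, in the form in which an affine inequality between two functions
  on the spectrum passes to the quadratic forms at a unit vector.
\<close>

lemma cfc_quadratic_form_affine_le:
  assumes P: "uniform_limit real_spectrum (\<lambda>n. poly (P n)) f sequentially"
    and Q: "uniform_limit real_spectrum (\<lambda>n. poly (Q n)) g sequentially"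
    and le: "\<And>t. t \<in> real_spectrum \<Longrightarrow> a * f t \<le> b * g t + c"
    and x: "norm x = 1"
  shows "a * Re (cinner (cfc f A x) x) \<le> b * Re (cinner (cfc g A x) x) + c"
proof -
  define R where "R n = smult b (Q n) + [:c:] - smult a (P n)" for n
  have "uniform_limit real_spectrum (\<lambda>n t. b * poly (Q n) t + c - a * poly (P n) t)
      (\<lambda>t. b * g t + c - a * f t) sequentially"
    by (intro uniform_limit_intros P Q)
  moreover have "poly (R n) = (\<lambda>t. b * poly (Q n) t + c - a * poly (P n) t)" for n
    by (simp add: R_def fun_eq_iff)
  ultimately have R: "uniform_limit real_spectrum (\<lambda>n. poly (R n)) (\<lambda>t. b * g t + c - a * f t) sequentially"
    by simp
  have quad: "Re (cinner (poly_op (R n + [:e:]) A x) x)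
      = b * Re (cinner (poly_op (Q n) A x) x) + (c + e) - a * Re (cinner (poly_op (P n) A x) x)" for n e
    using x by (simp add: R_def poly_op_diff poly_op_add poly_op_smult poly_op_const cinner_algebra
        Re_cinner_self)
  show ?thesis
  proof (rule field_le_epsilon)
    fix e :: real assume "0 < e"
    from uniform_limitD[OF R this]
    have "\<forall>\<^sub>F n in sequentially. 0 \<le> b * Re (cinner (poly_op (Q n) A x) x) + (c + e)
        - a * Re (cinner (poly_op (P n) A x) x)"
    proof eventually_elim
      case (elim n)
      have "0 \<le> poly (R n + [:e:]) t" if "t \<in> real_spectrum" for t
      proof -
        have "dist (poly (R n) t) (b * g t + c - a * f t) < e" using elim that by blast
        with le[OF that] show ?thesis by (simp add: dist_real_def abs_less_iff)
      qed
      from poly_op_nonneg[OF this, of x] show ?case by (simp only: quad)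
    qed
    then have "0 \<le> b * Re (cinner (cfc g A x) x) + (c + e) - a * Re (cinner (cfc f A x) x)"
      by (rule tendsto_lowerbound[rotated])
        (auto intro!: tendsto_intros cfc_quadratic_form_limit[OF P] cfc_quadratic_form_limit[OF Q])
    then show "a * Re (cinner (cfc f A x) x) \<le> b * Re (cinner (cfc g A x) x) + c + e" by simp
  qed
qed

end

section \<open>Powers of a positive operator\<close>

lemma symmetric_operator_positive_op:
  "bounded_clinear A \<Longrightarrow> positive_op A \<Longrightarrow> symmetric_operator A"
  by (simp add: symmetric_operator_def positive_op_symmetric)

lemma spectrum_positive_op_subset_interval:
  assumes "bounded_clinear A" "positive_op A"
  obtains M where "{t. complex_of_real t \<in> spectrum A} \<subseteq> {0..M}"
proof -
  obtain M where M: "0 < M" "\<And>x. norm (A x) \<le> norm x * M"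
    using bounded_linear.pos_bounded[OF bounded_clinear_imp_bounded_linear[OF assms(1)]] by blast
  have "{t. complex_of_real t \<in> spectrum A} \<subseteq> {0..M}"
    using M by (intro spectrum_positive_op[OF assms]) (simp_all add: mult.commute)
  then show thesis by (rule that)
qed

lemma continuous_on_rpower:
  assumes "0 \<le> s" "S \<subseteq> {0..}"
  shows "continuous_on S (\<lambda>t. rpower t s)"
proof (cases "s = 0")
  case False
  with assms have "continuous_on S (\<lambda>t. t powr s)"
    by (intro continuous_on_powr') (auto intro: continuous_intros)
  with False show ?thesis by (simp add: rpower_def)
qed (simp add: rpower_def)

lemma continuous_imp_uniform_limit_poly:
  fixes f :: "real \<Rightarrow> real"
  assumes "continuous_on {a..b} f"
  obtains P where "uniform_limit {a..b} (\<lambda>n. poly (P n)) f sequentially"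
proof -
  have "\<exists>p. \<forall>t\<in>{a..b}. \<bar>f t - poly p t\<bar> < 1 / Suc n" for n
  proof -
    have e: "0 < 1 / real (Suc n)" by simp
    obtain g where g: "real_polynomial_function g" "\<And>t. t \<in> {a..b} \<Longrightarrow> \<bar>f t - g t\<bar> < 1 / Suc n"
      using Stone_Weierstrass_real_polynomial_function[OF compact_Icc assms e] by blast
    then obtain c N where "g = (\<lambda>t. \<Sum>i\<le>N. c i * t ^ i)"
      unfolding real_polynomial_function_iff_sum by blast
    then have "g = poly (\<Sum>i\<le>N. monom (c i) i)" by (simp add: poly_sum poly_monom fun_eq_iff)
    with g(2) show ?thesis by blast
  qed
  then obtain P where P: "\<And>n t. t \<in> {a..b} \<Longrightarrow> \<bar>f t - poly (P n) t\<bar> < 1 / Suc n" by metis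
  have "uniform_limit {a..b} (\<lambda>n. poly (P n)) f sequentially"
  proof (rule uniform_limitI)
    fix e :: real assume "0 < e"
    then obtain N where N: "1 / real (Suc N) < e" using nat_approx_posE by metis
    have "dist (poly (P n) t) (f t) < e" if "N \<le> n" "t \<in> {a..b}" for n t
    proof -
      have "1 / real (Suc n) \<le> 1 / real (Suc N)" using that(1) by (simp add: frac_le)
      with P[OF that(2), of n] N show ?thesis by (simp add: dist_real_def abs_minus_commute)
    qed
    then show "\<forall>\<^sub>F n in sequentially. \<forall>t\<in>{a..b}. dist (poly (P n) t) (f t) < e"
      unfolding eventually_sequentially by blast
  qed
  then show thesis by (rule that)
qed

lemma rpower_uniform_limit_poly:
  assumes "bounded_clinear A" "positive_op A" "0 \<le> s"
  obtains P where
    "uniform_limit {t. complex_of_real t \<in> spectrum A} (\<lambda>n. poly (P n)) (\<lambda>t. rpower t s) sequentially"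
proof -
  obtain M where M: "{t. complex_of_real t \<in> spectrum A} \<subseteq> {0..M}"
    using assms(1,2) by (rule spectrum_positive_op_subset_interval)
  have "continuous_on {0..M} (\<lambda>t. rpower t s)" using assms(3) by (intro continuous_on_rpower) auto
  then show thesis
    using continuous_imp_uniform_limit_poly uniform_limit_on_subset[OF _ M] that by metis
qed

lemma op_power_clinear:
  assumes "bounded_clinear A" "positive_op A" "0 \<le> s"
  shows "bounded_clinear (op_power A s)"
proof -
  interpret symmetric_operator A using assms by (intro symmetric_operator_positive_op)
  show ?thesis
    unfolding op_power_def by (rule rpower_uniform_limit_poly[OF assms]) (rule cfc_limit(1))
qed

lemma op_power_symmetric:
  assumes "bounded_clinear A" "positive_op A" "0 \<le> s"
  shows "cinner (op_power A s x) y = cinner x (op_power A s y)"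
proof -
  interpret symmetric_operator A using assms by (intro symmetric_operator_positive_op)
  show ?thesis
    unfolding op_power_def by (rule rpower_uniform_limit_poly[OF assms]) (rule cfc_symmetric)
qed

lemma op_power_0:
  assumes "bounded_clinear A" "positive_op A"
  shows "op_power A 0 x = x"
proof -
  interpret symmetric_operator A using assms by (intro symmetric_operator_positive_op)
  show ?thesis by (simp add: op_power_def rpower_def cfc_one)
qed

lemma norm_op_power_square:
  assumes A: "bounded_clinear A" "positive_op A" and s: "0 \<le> s"
  shows "(norm (op_power A s x))\<^sup>2 = Re (cinner (op_power A (2 * s) x) x)"
proof -
  interpret symmetric_operator A using A by (rule symmetric_operator_positive_op)
  obtain P where P: "uniform_limit real_spectrum (\<lambda>n. poly (P n)) (\<lambda>t. rpower t s) sequentially"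
    using rpower_uniform_limit_poly[OF A s] .
  obtain M where M: "real_spectrum \<subseteq> {0..M}" using A by (rule spectrum_positive_op_subset_interval)
  have "compact ((\<lambda>t. rpower t s) ` {0..M})"
    using s by (intro compact_continuous_image continuous_on_rpower) auto
  then have "bounded ((\<lambda>t. rpower t s) ` real_spectrum)"
    using M by (meson bounded_subset compact_imp_bounded image_mono)
  moreover have "rpower t s * rpower t s = rpower t (2 * s)" for t
    by (simp add: rpower_def flip: powr_add)
  ultimately show ?thesis using norm_cfc_square[OF P] by (simp add: op_power_def)
qed

lemma op_power_quadratic_form_nonneg:
  assumes A: "bounded_clinear A" "positive_op A" and "0 \<le> s"
  shows "0 \<le> Re (cinner (op_power A s x) x)"
  using norm_op_power_square[OF A, of "s / 2" x, symmetric] assms(3) by simp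

lemma Youngs_inequality_weighted:
  fixes a b :: real
  assumes "0 < u" "0 < v" "u + v = 1" "0 \<le> a" "0 \<le> b"
  shows "a powr u * b powr v \<le> u * a + v * b"
  using Youngs_inequality_0[of u v a b] assms by (cases "a = 0 \<or> b = 0") auto

text \<open>
  The Hoelder--McCarthy inequality: Jensen's inequality for the concave power \<open>s / t\<close> and the
  spectral measure of \<open>x\<close>. Young's inequality is the tangent line inequality at \<open>c\<close>,
  multiplied by \<open>c powr (1 - s / t)\<close>; it passes to quadratic forms by positivity of the
  calculus. The best tangent point is \<open>c = \<langle>A\<^sup>t x, x\<rangle>\<close>, which is approached from above
  because it can be \<open>0\<close>.
\<close>

lemma Hoelder_McCarthy:
  fixes A :: "'a::complex_hilbert_space \<Rightarrow> 'a"
  assumes A: "bounded_clinear A" "positive_op A" and st: "0 < s" "s \<le> t" and x: "norm x = 1"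
  shows "Re (cinner (op_power A s x) x) \<le> Re (cinner (op_power A t x) x) powr (s / t)"
proof (cases "s = t")
  case True
  then show ?thesis
    using op_power_quadratic_form_nonneg[OF A] st
    by (simp add: powr_one)
next
  case False
  interpret symmetric_operator A using A by (rule symmetric_operator_positive_op)
  let ?q = "\<lambda>s. Re (cinner (op_power A s x) x)"
  define k where "k = s / t"
  have t: "0 < t" and k: "0 < k" "k < 1" using st False by (auto simp: k_def)
  have q_nonneg: "0 \<le> ?q t"
    using op_power_quadratic_form_nonneg[OF A] t by simp
  obtain P where P: "uniform_limit real_spectrum (\<lambda>n. poly (P n)) (\<lambda>l. rpower l s) sequentially"
    using rpower_uniform_limit_poly[OF A] st by (metis less_imp_le)
  obtain Q where Q: "uniform_limit real_spectrum (\<lambda>n. poly (Q n)) (\<lambda>l. rpower l t) sequentially"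
    using rpower_uniform_limit_poly[OF A] t by (metis less_imp_le)
  obtain M where M: "real_spectrum \<subseteq> {0..M}" using A by (rule spectrum_positive_op_subset_interval)
  \<comment> \<open>The argument needs a positive tangent point, so it is shifted off \<open>?q t\<close> by \<open>e\<close>.\<close>
  have bound: "?q s \<le> (?q t + e) powr k" if e: "0 < e" for e
  proof -
    define c where "c = ?q t + e"
    have c: "0 < c" using q_nonneg e by (simp add: c_def)
    have "c powr (1 - k) * ?q s \<le> k * ?q t + (1 - k) * c"
      unfolding op_power_def
    proof (rule cfc_quadratic_form_affine_le[OF P Q _ x])
      fix l assume "l \<in> real_spectrum"
      with M have l: "0 \<le> l" by auto
      have "(l powr t) powr k * c powr (1 - k) \<le> k * l powr t + (1 - k) * c"
        using k c by (intro Youngs_inequality_weighted) auto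
      moreover have "(l powr t) powr k = l powr s" using t by (simp add: powr_powr k_def)
      ultimately show "c powr (1 - k) * rpower l s \<le> k * rpower l t + (1 - k) * c"
        using st t by (simp add: rpower_def mult.commute)
    qed
    also have "\<dots> \<le> k * c + (1 - k) * c" using k e by (simp add: c_def)
    also have "\<dots> = c powr (1 - k) * c powr k"
      using c by (simp add: algebra_simps flip: powr_add)
    finally show ?thesis using c by (simp add: c_def)
  qed
  have "((\<lambda>e. (?q t + e) powr k) \<longlongrightarrow> (?q t + 0) powr k) (at_right 0)"
    using q_nonneg k
    by (intro tendsto_powr' tendsto_intros) (auto simp: eventually_at_filter)
  moreover have "\<forall>\<^sub>F e in at_right 0. ?q s \<le> (?q t + e) powr k"
    using bound by (auto simp: eventually_at_filter)
  ultimately have "?q s \<le> (?q t + 0) powr k" by (rule tendsto_lowerbound) simp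
  then show ?thesis by (simp add: k_def)
qed


section \<open>The numerical radius inequality\<close>

lemma norm_op_power_le:
  assumes A: "bounded_clinear A" "positive_op A" and "0 < \<alpha>" "2 * \<alpha> \<le> t" "norm x = 1"
  shows "norm (op_power A \<alpha> x) \<le> Re (cinner (op_power A t x) x) powr (\<alpha> / t)"
proof (rule power2_le_imp_le)
  have "(norm (op_power A \<alpha> x))\<^sup>2 = Re (cinner (op_power A (2 * \<alpha>) x) x)"
    using assms by (intro norm_op_power_square) auto
  also have "\<dots> \<le> Re (cinner (op_power A t x) x) powr (2 * \<alpha> / t)"
    using assms by (intro Hoelder_McCarthy) auto
  also have "\<dots> = (Re (cinner (op_power A t x) x) powr (\<alpha> / t))\<^sup>2"
    by (simp add: power2_eq_square flip: powr_add)
  finally show "(norm (op_power A \<alpha> x))\<^sup>2 \<le> (Re (cinner (op_power A t x) x) powr (\<alpha> / t))\<^sup>2" .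
qed simp

lemma cmod_quadratic_form_op_power_product_le:
  assumes A: "bounded_clinear A" "positive_op A" and B: "bounded_clinear B" "positive_op B"
    and X: "bounded_clinear X" and \<alpha>: "0 \<le> \<alpha>"
  shows "cmod (cinner (op_power A \<alpha> (X (op_power B \<alpha> x))) x)
    \<le> onorm X * (norm (op_power A \<alpha> x) * norm (op_power B \<alpha> x))"
proof -
  have "cmod (cinner (op_power A \<alpha> (X (op_power B \<alpha> x))) x)
      = cmod (cinner (X (op_power B \<alpha> x)) (op_power A \<alpha> x))"
    by (simp add: op_power_symmetric[OF A \<alpha>])
  also have "\<dots> \<le> norm (X (op_power B \<alpha> x)) * norm (op_power A \<alpha> x)"
    by (rule norm_cinner_le)
  also have "\<dots> \<le> onorm X * norm (op_power B \<alpha> x) * norm (op_power A \<alpha> x)"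
    using X by (intro mult_right_mono onorm bounded_clinear_imp_bounded_linear) auto
  finally show ?thesis by (simp add: mult_ac)
qed

text \<open>
  Both factors are estimated at the exponents \<open>p r\<close> and \<open>q r\<close> that occur in the theorem, so that
  the remaining product is a power of a weighted geometric mean with weights \<open>1 / p\<close> and \<open>1 / q\<close>.
\<close>

lemma norm_op_power_product_le:
  assumes A: "bounded_clinear A" "positive_op A" and B: "bounded_clinear B" "positive_op B"
    and \<alpha>: "0 < \<alpha>" "\<alpha> \<le> 1" and r: "0 < r"
    and pq: "1 < p" "1 < q" "1 / p + 1 / q = 1" "2 \<le> p * r" "2 \<le> q * r"
    and x: "norm x = 1"
  shows "norm (op_power A \<alpha> x) * norm (op_power B \<alpha> x)
    \<le> onorm (\<lambda>x. (1 / p) *\<^sub>R op_power A (p * r) x + (1 / q) *\<^sub>R op_power B (q * r) x) powr (\<alpha> / r)"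
    (is "_ \<le> onorm ?S powr _")
proof -
  let ?a = "Re (cinner (op_power A (p * r) x) x)" and ?b = "Re (cinner (op_power B (q * r) x) x)"
  have a: "0 \<le> ?a" and b: "0 \<le> ?b"
    using op_power_quadratic_form_nonneg[OF A] op_power_quadratic_form_nonneg[OF B] pq by simp_all
  have "bounded_clinear ?S"
    using A B pq by (intro bounded_clinear_add bounded_clinear_scaleR op_power_clinear) auto
  then have S: "bounded_linear ?S" by (rule bounded_clinear_imp_bounded_linear)
  have "?a powr (1 / p) * ?b powr (1 / q) \<le> 1 / p * ?a + 1 / q * ?b"
    using pq a b by (intro Youngs_inequality_weighted) auto
  also have "\<dots> = Re (cinner (?S x) x)" by (simp add: cinner_algebra)
  also have "\<dots> \<le> norm (?S x) * norm x" by (rule Re_cinner_le_norm)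
  also have "\<dots> \<le> onorm ?S" using onorm[OF S, of x] x by simp
  finally have le: "?a powr (1 / p) * ?b powr (1 / q) \<le> onorm ?S" .
  have "norm (op_power A \<alpha> x) * norm (op_power B \<alpha> x) \<le> ?a powr (\<alpha> / (p * r)) * ?b powr (\<alpha> / (q * r))"
    using A B \<alpha> pq x by (intro mult_mono[OF norm_op_power_le norm_op_power_le]) auto
  also have "\<dots> = (?a powr (1 / p) * ?b powr (1 / q)) powr (\<alpha> / r)"
    by (simp add: powr_mult powr_powr mult.commute)
  also have "\<dots> \<le> onorm ?S powr (\<alpha> / r)"
    using \<alpha> r le by (intro powr_mono2) auto
  finally show ?thesis .
qed

lemma numerical_radius_le:
  assumes "0 \<le> K" "\<And>x. norm x = 1 \<Longrightarrow> cmod (cinner (T x) x) \<le> K"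
  shows "numerical_radius T \<le> K"
  unfolding numerical_radius_def using assms by (intro cSup_least) auto

lemma numerical_radius_nonneg:
  assumes "\<And>x. norm x = 1 \<Longrightarrow> cmod (cinner (T x) x) \<le> K"
  shows "0 \<le> numerical_radius T"
  unfolding numerical_radius_def
  using assms by (intro cSup_upper bdd_aboveI[of _ "max 0 K"]) (auto simp: le_max_iff_disj)

theorem theorem3p1:
  fixes A B X :: "'a::complex_hilbert_space \<Rightarrow> 'a" and \<alpha> r p q :: real
  assumes "bounded_clinear A" and "bounded_clinear B" and "bounded_clinear X"
    and "positive_op A" and "positive_op B"
    and "0 \<le> \<alpha>" and "\<alpha> \<le> 1" and "0 \<le> r"
    and "1 < p" and "1 < q" and "1 / p + 1 / q = 1"
    and "2 \<le> p * r" and "2 \<le> q * r"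
  shows "rpower (numerical_radius (op_power A \<alpha> \<circ> X \<circ> op_power B \<alpha>)) r
    \<le> rpower (onorm X) r *
      rpower (onorm (\<lambda>x. (1 / p) *\<^sub>R op_power A (p * r) x + (1 / q) *\<^sub>R op_power B (q * r) x)) \<alpha>"
proof -
  let ?T = "op_power A \<alpha> \<circ> X \<circ> op_power B \<alpha>"
  let ?N = "onorm (\<lambda>x. (1 / p) *\<^sub>R op_power A (p * r) x + (1 / q) *\<^sub>R op_power B (q * r) x)"
  \<comment> \<open>For \<open>\<alpha> = 0\<close> both powers are the identity and \<open>K\<close> must be \<open>1\<close> even if the norm is \<open>0\<close>;
    this is what \<open>rpower\<close> gives.\<close>
  define K where "K = rpower ?N (\<alpha> / r)"
  have r: "0 < r" using assms(8,12) by (cases "r = 0") auto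
  have K: "0 \<le> K" by (simp add: K_def rpower_def)
  have X: "0 \<le> onorm X" using assms(3) by (intro onorm_pos_le bounded_clinear_imp_bounded_linear)
  have "norm (op_power A \<alpha> x) * norm (op_power B \<alpha> x) \<le> K" if "norm x = 1" for x
  proof (cases "\<alpha> = 0")
    case True
    with assms that show ?thesis by (simp add: K_def rpower_def op_power_0)
  next
    case False
    with assms r that show ?thesis by (simp add: K_def rpower_def norm_op_power_product_le)
  qed
  then have T: "cmod (cinner (?T x) x) \<le> onorm X * K" if "norm x = 1" for x
    using cmod_quadratic_form_op_power_product_le[OF assms(1,4,2,5,3,6), of x]
      mult_left_mono[OF _ X] that by fastforce
  have "0 \<le> numerical_radius ?T" using T by (rule numerical_radius_nonneg)
  moreover have "numerical_radius ?T \<le> onorm X * K" using X K T by (intro numerical_radius_le) auto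
  ultimately have "numerical_radius ?T powr r \<le> (onorm X * K) powr r"
    using r by (intro powr_mono2) auto
  also have "\<dots> = onorm X powr r * rpower ?N \<alpha>"
    using X K r by (simp add: powr_mult K_def rpower_def powr_powr)
  finally show ?thesis using r by (simp add: rpower_def)
qed

end
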